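(* Let $d>2$ be even. The condition $\max_k p_k\le \frac{1}{d-1}$ on a $d$-dimensional probability vector $\boldsymbol p$ is not sufficient for the existence of $d-1$ perfectly distinguishable quantum states on $\mathbb{C}^d$ with the same classical version $\boldsymbol p$. Equivalently, $\mathcal{A}_d^{d-1}\ne\mathcal{P}_d^{d-1}$.
   Context: Fix an orthonormal basis $\{|k\rangle\}_{k=1}^d$ of $\mathbb{C}^d$. A quantum state is a positive semidefinite $d\times d$ matrix $\rho$ with $\mathrm{Tr}\,\rho=1$. Its classical version is the probability vector $\boldsymbol p$ with $p_k=\langle k|\rho|k\rangle$. A set of states is perfectly distinguishable if the states have pairwise orthogonal supports (i.e. $\rho^{(m)}\rho^{(n)}=0$ for $m\ne n$). $\Delta_d$ is the set of $d$-dimensional probability vectors. The $M$-distinguishability region $\mathcal{A}_d^M\subseteq\Delta_d$ is the set of all $\boldsymbol p\in\Delta_d$ for which there exist $M$ perfectly distinguishable quantum states all having classical version $\boldsymbol p$. $\boldsymbol v^M\in\Delta_d$ is the vector whose first $M$ entries equal $1/M$ and whose other entries are $0$. The permutohedron $\mathcal{P}_d^M$ is the convex hull of all permutations of the coordinates of $\boldsymbol v^M$. *)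

theory Defs
  imports "HOL-Analysis.Analysis"
begin

definition braket :: "complex ^ 'n \<Rightarrow> complex ^ 'n \<Rightarrow> complex" where
  "braket x y = (\<Sum>i\<in>UNIV. cnj (x $ i) * y $ i)"

text \<open>An orthonormal family indexed by \<^typ>\<open>'n\<close> has as many members as the dimension,
  hence it spans.\<close>

definition orthonormal_basis :: "('n \<Rightarrow> complex ^ 'n) \<Rightarrow> bool" where
  "orthonormal_basis ket \<longleftrightarrow> (\<forall>i j. braket (ket i) (ket j) = (if i = j then 1 else 0))"

definition positive_semidefinite :: "complex ^ 'n ^ 'n \<Rightarrow> bool" where
  "positive_semidefinite A \<longleftrightarrow>
     (\<forall>i j. A $ j $ i = cnj (A $ i $ j)) \<and> (\<forall>x. 0 \<le> Re (braket x (A *v x)))"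

definition quantum_state :: "complex ^ 'n ^ 'n \<Rightarrow> bool" where
  "quantum_state \<rho> \<longleftrightarrow> positive_semidefinite \<rho> \<and> trace \<rho> = 1"

text \<open>For Hermitian \<open>\<rho>\<close> the diagonal matrix elements are real, so \<^const>\<open>Re\<close> loses nothing.\<close>

definition classical_version ::
    "('n \<Rightarrow> complex ^ 'n) \<Rightarrow> complex ^ 'n ^ 'n \<Rightarrow> real ^ 'n" where
  "classical_version ket \<rho> = (\<chi> k. Re (braket (ket k) (\<rho> *v ket k)))"

definition perfectly_distinguishable :: "nat \<Rightarrow> (nat \<Rightarrow> complex ^ 'n ^ 'n) \<Rightarrow> bool" where
  "perfectly_distinguishable M \<rho> \<longleftrightarrow> (\<forall>m<M. \<forall>n<M. m \<noteq> n \<longrightarrow> \<rho> m ** \<rho> n = 0)"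

definition probability_vectors :: "(real ^ 'n) set" where
  "probability_vectors = {p. (\<forall>k. 0 \<le> p $ k) \<and> (\<Sum>k\<in>UNIV. p $ k) = 1}"

definition has_distinguishable_states ::
    "('n \<Rightarrow> complex ^ 'n) \<Rightarrow> nat \<Rightarrow> real ^ 'n \<Rightarrow> bool" where
  "has_distinguishable_states ket M p \<longleftrightarrow>
     (\<exists>\<rho>. (\<forall>m<M. quantum_state (\<rho> m) \<and> classical_version ket (\<rho> m) = p) \<and>
          perfectly_distinguishable M \<rho>)"

definition distinguishability_region ::
    "('n \<Rightarrow> complex ^ 'n) \<Rightarrow> nat \<Rightarrow> (real ^ 'n) set" where
  "distinguishability_region ket M =
     {p \<in> probability_vectors. has_distinguishable_states ket M p}"

text \<open>The linear order on the index type gives meaning to ``the first \<open>M\<close> entries'':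
  an index is among them iff fewer than \<open>M\<close> indices precede it.\<close>

definition uniform_prefix :: "nat \<Rightarrow> real ^ 'n::{finite,linorder}" where
  "uniform_prefix M = (\<chi> i. if card {j. j < i} < M then 1 / real M else 0)"

definition permutohedron :: "nat \<Rightarrow> (real ^ 'n::{finite,linorder}) set" where
  "permutohedron M =
     convex hull {(\<chi> i. uniform_prefix M $ \<pi> i) |\<pi>. \<pi> permutes UNIV}"

end

theory Submission
  imports Defs
begin

text \<open>
  Let \<open>M = d - 1\<close> and let \<open>p\<close> be \<open>2/(3M)\<close> at three indices \<open>a, b, c\<close> and \<open>1/M\<close> elsewhere; this is
  the average of three vertices of the permutohedron. Suppose that \<open>M\<close> orthogonal states
  have classical version \<open>p\<close>, with matrices \<open>R m\<close> in the given basis. An index \<open>e\<close> with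
  \<open>p e = 1/M\<close> turns the estimate for the \<open>e\<close>-th columns of the \<open>R m\<close> into an equality, and this
  forces every \<open>R m\<close> to be a projection of rank one. So \<open>T = 1 - (\<Sum>m. R m)\<close> is a projection
  with diagonal \<open>1/3\<close> at \<open>a, b, c\<close> and \<open>0\<close> elsewhere, and its entries at \<open>a, b, c\<close> have modulus
  \<open>1/3\<close>. The \<open>(a, a)\<close> entry of \<open>T R m = 0\<close> says that three numbers of equal modulus, one of them
  real, sum to zero; they form an equilateral triangle with one of two orientations. The sum over
  \<open>m\<close> of the second number is real, so both orientations occur equally often, which is
  impossible for odd \<open>M\<close>.
\<close>

section \<open>Parity of signed sums and unit triangles\<close>

text \<open>Each new term moves both \<open>k\<close> and the cardinality by one. Hence an odd
  number of terms \<open>s\<close> or \<open>- s\<close>, with \<open>s\<close> nonzero, cannot sum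
  to zero.\<close>

lemma sum_plus_minus_parity:
  fixes f :: "'a \<Rightarrow> real"
  assumes "finite S" "\<And>x. x \<in> S \<Longrightarrow> f x = s \<or> f x = - s"
  shows "\<exists>k::int. sum f S = s * of_int k \<and> (even k \<longleftrightarrow> even (card S))"
  using assms
proof (induction S rule: finite_induct)
  case empty
  show ?case by (intro exI[of _ 0]) simp
next
  case (insert x S)
  then obtain k where k: "sum f S = s * of_int k" "even k \<longleftrightarrow> even (card S)"
    by blast
  have "f x = s \<or> f x = - s" using insert.prems by simp
  then show ?case
  proof
    assume "f x = s"
    with k insert.hyps show ?thesis
      by (intro exI[of _ "k + 1"]) (simp add: algebra_simps)
  next
    assume "f x = - s"
    with k insert.hyps show ?thesis
      by (intro exI[of _ "k - 1"]) (simp add: algebra_simps)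
  qed
qed

text \<open>Equal moduli of \<open>x\<close> and \<open>- 1 - x\<close> force
  \<open>Re x = - 1 / 2\<close>, so \<open>x\<close> is one of the two nonreal cube roots of unity.
  The sign of \<open>Im x\<close> records the orientation of the triangle.\<close>

lemma Im_of_unit_triangle:
  fixes x y :: complex
  assumes "cmod x = 1" "cmod y = 1" "1 + x + y = 0"
  shows "Im x = sqrt 3 / 2 \<or> Im x = - (sqrt 3 / 2)"
proof -
  have y: "Re y = - 1 - Re x" "Im y = - Im x"
    using assms(3) by (auto simp: complex_eq_iff algebra_simps)
  have x1: "(Re x)\<^sup>2 + (Im x)\<^sup>2 = 1" and "(Re y)\<^sup>2 + (Im y)\<^sup>2 = 1"
    using assms by (auto simp flip: cmod_power2)
  then have "Re x = - 1 / 2" by (simp add: y power2_eq_square algebra_simps)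
  with x1 have "(Im x)\<^sup>2 = (sqrt 3 / 2)\<^sup>2"
    by (simp add: power2_eq_square field_simps)
  then show ?thesis by (simp add: power2_eq_iff)
qed

section \<open>The bracket as a sesquilinear form\<close>

lemma braket_add_right: "braket x (y + z) = braket x y + braket x z"
  by (simp add: braket_def algebra_simps sum.distrib)

lemma braket_add_left: "braket (x + y) z = braket x z + braket y z"
  by (simp add: braket_def algebra_simps sum.distrib)

lemma braket_scale_right: "braket x (c *s y) = c * braket x y"
  by (simp add: braket_def algebra_simps sum_distrib_left)

lemma braket_scale_left: "braket (c *s x) y = cnj c * braket x y"
  by (simp add: braket_def algebra_simps sum_distrib_left)

lemma braket_axis_left: "braket (axis i c) x = cnj c * x $ i"
proof -
  have "braket (axis i c) x = (\<Sum>j\<in>UNIV. if j = i then cnj c * x $ i else 0)"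
    unfolding braket_def by (intro sum.cong) (auto simp: axis_def)
  then show ?thesis by simp
qed

lemma matrix_vector_axis: "((A :: complex ^ 'n ^ 'n) *v axis j c) $ i = A $ i $ j * c"
  by (simp add: matrix_vector_mult_def axis_def if_distrib cong: if_cong)

lemma hermitian_braket:
  assumes "\<And>i j. (A :: complex ^ 'n ^ 'n) $ j $ i = cnj (A $ i $ j)"
  shows "braket x (A *v y) = cnj (braket y (A *v x))"
proof -
  have "braket x (A *v y) = (\<Sum>i\<in>UNIV. \<Sum>j\<in>UNIV. cnj (x $ i) * (A $ i $ j * y $ j))"
    by (simp add: braket_def matrix_vector_mult_def sum_distrib_left)
  also have "\<dots> = (\<Sum>j\<in>UNIV. \<Sum>i\<in>UNIV. cnj (x $ i) * (cnj (A $ j $ i) * y $ j))"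
    by (subst sum.swap) (simp flip: assms)
  also have "\<dots> = cnj (braket y (A *v x))"
    by (simp add: braket_def matrix_vector_mult_def sum_distrib_left mult_ac)
  finally show ?thesis .
qed

section \<open>Positive semidefinite matrices and their minors\<close>

lemma positive_semidefinite_Cauchy_Schwarz:
  assumes "positive_semidefinite A"
  shows "(cmod (braket y (A *v x)))\<^sup>2 \<le> Re (braket x (A *v x)) * Re (braket y (A *v y))"
proof -
  define s where "s = braket y (A *v x)"
  have herm: "A $ j $ i = cnj (A $ i $ j)" and pos: "0 \<le> Re (braket z (A *v z))" for i j z
    using assms unfolding positive_semidefinite_def by blast+
  have s': "braket x (A *v y) = cnj s"
    unfolding s_def by (rule hermitian_braket) (rule herm)
  have quad: "0 \<le> Re (braket x (A *v x)) - 2 * t * (cmod s)\<^sup>2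
      + t\<^sup>2 * (cmod s)\<^sup>2 * Re (braket y (A *v y))" for t :: real
  proof -
    \<comment> \<open>The factor \<open>s\<close> makes both cross terms equal to the real number
      \<open>- t * (cmod s)\<^sup>2\<close>.\<close>
    define c where "c = - of_real t * s"
    have "braket (x + c *s y) (A *v (x + c *s y))
        = braket x (A *v x) + c * cnj s + cnj c * s + (cnj c * c) * braket y (A *v y)"
      by (simp add: matrix_vector_right_distrib vector_scalar_commute braket_add_left
          braket_add_right braket_scale_left braket_scale_right s' s_def[symmetric] algebra_simps)
    also have "cnj c * c = of_real (t\<^sup>2 * (cmod s)\<^sup>2)"
      by (simp only: of_real_mult complex_norm_square) (simp add: c_def power2_eq_square)
    also have "c * cnj s = of_real (- t * (cmod s)\<^sup>2)"
      by (simp only: of_real_mult complex_norm_square) (simp add: c_def)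
    also have "cnj c * s = of_real (- t * (cmod s)\<^sup>2)"
      by (simp only: of_real_mult complex_norm_square) (simp add: c_def)
    finally show ?thesis
      using pos[of "x + c *s y"] by simp
  qed
  define \<alpha> where "\<alpha> = Re (braket y (A *v y))"
  define \<beta> where "\<beta> = Re (braket x (A *v x))"
  have "(cmod s)\<^sup>2 \<le> \<beta> * \<alpha>"
  proof (cases "\<alpha> = 0")
    case True
    show ?thesis
    proof (rule ccontr)
      assume "\<not> ?thesis"
      then have "(cmod s)\<^sup>2 > 0" using True by simp
      \<comment> \<open>For \<open>\<alpha> = 0\<close> the bound in \<open>quad\<close> is linear
        in \<open>t\<close>, and this \<open>t\<close> brings it down to
        \<open>- \<beta> - 2\<close>.\<close>
      then show False
        using quad[of "(\<beta> + 1) / (cmod s)\<^sup>2"] pos[of x] True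
        by (simp add: \<alpha>_def[symmetric] \<beta>_def[symmetric])
    qed
  next
    case False
    then have "\<alpha> > 0" using pos[of y] by (simp add: \<alpha>_def)
    \<comment> \<open>The quadratic polynomial in \<open>quad\<close> has its minimum at
      \<open>t = 1 / \<alpha>\<close>, up to the degenerate case \<open>s = 0\<close>.\<close>
    then show ?thesis
      using quad[of "1 / \<alpha>"] unfolding \<alpha>_def[symmetric] \<beta>_def[symmetric]
      by (simp add: field_simps power2_eq_square)
  qed
  then show ?thesis by (simp add: s_def \<alpha>_def \<beta>_def)
qed

lemma positive_semidefinite_diagonal:
  assumes "positive_semidefinite A"
  shows "A $ i $ i = of_real (Re (A $ i $ i))" "0 \<le> Re (A $ i $ i)"
proof -
  have "A $ i $ i = cnj (A $ i $ i)"
    using assms unfolding positive_semidefinite_def by blast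
  then show "A $ i $ i = of_real (Re (A $ i $ i))" by (simp add: complex_eq_iff)
  have "0 \<le> Re (braket (axis i 1) (A *v axis i 1))"
    using assms unfolding positive_semidefinite_def by blast
  then show "0 \<le> Re (A $ i $ i)" by (simp add: braket_axis_left matrix_vector_axis)
qed

lemma positive_semidefinite_minor:
  assumes "positive_semidefinite A"
  shows "(cmod (A $ i $ j))\<^sup>2 \<le> Re (A $ i $ i) * Re (A $ j $ j)"
  using positive_semidefinite_Cauchy_Schwarz[OF assms, of "axis i 1" "axis j 1"]
  by (simp add: braket_axis_left matrix_vector_axis mult.commute)

lemma positive_semidefinite_minor_eq:
  assumes psd: "positive_semidefinite A"
    and eq: "(cmod (A $ j $ k))\<^sup>2 = Re (A $ j $ j) * Re (A $ k $ k)"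
  shows "A $ i $ j * A $ k $ k = A $ i $ k * A $ k $ j"
proof -
  \<comment> \<open>The 2x2 minor vanishes, so this vector is isotropic and hence in the kernel of \<open>A\<close>.\<close>
  define x where "x = axis j (A $ k $ k) + axis k (- A $ k $ j)"
  have herm: "A $ j $ i = cnj (A $ i $ j)" for i j
    using psd unfolding positive_semidefinite_def by blast
  have Ax: "(A *v x) $ i = A $ i $ j * A $ k $ k - A $ i $ k * A $ k $ j" for i
    by (simp add: x_def matrix_vector_right_distrib matrix_vector_axis)
  have "A $ j $ k * A $ k $ j = of_real ((cmod (A $ j $ k))\<^sup>2)"
    by (simp only: complex_norm_square) (simp flip: herm)
  also have "\<dots> = A $ j $ j * A $ k $ k"
    using positive_semidefinite_diagonal(1)[OF psd] by (metis eq of_real_mult)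
  finally have "braket x (A *v x) = 0"
    by (simp add: x_def[THEN arg_cong, of "\<lambda>y. braket y _"] braket_add_left braket_axis_left Ax)
  then have "(cmod (braket (axis i 1) (A *v x)))\<^sup>2 \<le> 0"
    using positive_semidefinite_Cauchy_Schwarz[OF psd, of "axis i 1" x] by simp
  then show ?thesis by (simp add: braket_axis_left Ax)
qed


text \<open>Equality in the minors with \<open>e\<close> makes \<open>A\<close> the product of its
  \<open>e\<close>-th column and \<open>e\<close>-th row, divided by \<open>A $ e $ e\<close>. So
  \<open>A\<close> has rank one and all its 2x2 minors vanish.\<close>

lemma rank_one_entries:
  assumes psd: "positive_semidefinite A"
    and e: "A $ e $ e \<noteq> 0"
    and eq: "\<And>j. (cmod (A $ j $ e))\<^sup>2 = Re (A $ j $ j) * Re (A $ e $ e)"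
  shows "A $ i $ k * A $ k $ j = A $ k $ k * A $ i $ j"
proof -
  have 1: "A $ i $ j * A $ e $ e = A $ i $ e * A $ e $ j" for i j
    by (rule positive_semidefinite_minor_eq[OF psd eq])
  have "(A $ i $ k * A $ k $ j) * (A $ e $ e * A $ e $ e)
      = (A $ i $ k * A $ e $ e) * (A $ k $ j * A $ e $ e)" by (simp only: mult_ac)
  also have "\<dots> = (A $ k $ e * A $ e $ k) * (A $ i $ e * A $ e $ j)"
    by (simp only: 1) (simp only: mult_ac)
  also have "\<dots> = (A $ k $ k * A $ e $ e) * (A $ i $ j * A $ e $ e)"
    by (simp only: 1)
  also have "\<dots> = (A $ k $ k * A $ i $ j) * (A $ e $ e * A $ e $ e)" by (simp only: mult_ac)
  finally show ?thesis using e by simp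
qed

section \<open>The contradiction in the standard basis\<close>

lemma no_orthogonal_family:
  fixes R :: "nat \<Rightarrow> complex ^ 'n ^ 'n" and p :: "'n \<Rightarrow> real"
  assumes M: "odd M"
    and distinct: "a \<noteq> b" "a \<noteq> c" "b \<noteq> c" "e \<notin> {a, b, c}"
    and p: "\<And>k. p k = (if k \<in> {a, b, c} then 2 / (3 * real M) else 1 / real M)"
    and sum_p: "(\<Sum>k\<in>UNIV. p k) = 1"
    and psd: "\<And>m. m < M \<Longrightarrow> positive_semidefinite (R m)"
    and diag: "\<And>m k. m < M \<Longrightarrow> Re (R m $ k $ k) = p k"
    and orth: "\<And>m n. \<lbrakk>m < M; n < M; m \<noteq> n\<rbrakk> \<Longrightarrow> R m ** R n = 0"
  shows False
proof -
  have M0: "real M > 0" using M by (auto intro: Nat.gr0I)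
  have herm: "cnj (R m $ i $ j) = R m $ j $ i" if "m < M" for m i j
    using psd[OF that] unfolding positive_semidefinite_def by metis
  have diag': "R m $ k $ k = of_real (p k)" if "m < M" for m k
    using positive_semidefinite_diagonal(1)[OF psd[OF that]] diag[OF that] by metis
  have pe: "p e = 1 / real M" using distinct by (simp add: p)
  have prod: "(\<Sum>k\<in>UNIV. R m $ i $ k * R n $ k $ j) = (R m ** R n) $ i $ j" for m n i j
    by (simp add: matrix_matrix_mult_def)

  \<comment> \<open>\<open>s m\<close> is the squared norm of the \<open>e\<close>-th column of
    \<open>R m\<close>, and \<open>V\<close> is the sum of these columns. They are pairwise
    orthogonal, so Pythagoras will give \<open>norm_V\<close>.\<close>
  define s where "s m = (\<Sum>j\<in>UNIV. (cmod (R m $ j $ e))\<^sup>2)" for m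
  define V where "V j = (\<Sum>m<M. R m $ j $ e)" for j
  have minor: "(cmod (R m $ j $ e))\<^sup>2 \<le> p j * p e" if "m < M" for m j
    using positive_semidefinite_minor[OF psd[OF that]] diag[OF that] by metis
  have s_le: "s m \<le> p e" if "m < M" for m
  proof -
    have "s m \<le> (\<Sum>j\<in>UNIV. p j * p e)"
      unfolding s_def by (intro sum_mono minor that)
    also have "\<dots> = p e" by (simp add: sum_p flip: sum_distrib_right)
    finally show ?thesis .
  qed
  \<comment> \<open>As \<open>R m\<close> is Hermitian, the inner product of the \<open>e\<close>-th
    columns of \<open>R m\<close> and \<open>R n\<close> is the \<open>(e, e)\<close> entry of
    \<open>R m ** R n\<close>.\<close>
  have sq: "(\<Sum>k\<in>UNIV. R m $ e $ k * R n $ k $ e) = (if m = n then of_real (s m) else 0)"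
    if "m < M" "n < M" for m n
  proof (cases "m = n")
    case True
    then show ?thesis
      using that by (simp add: s_def complex_norm_square herm mult.commute del: of_real_power)
  qed (use that in \<open>simp add: prod orth\<close>)
  have "of_real (\<Sum>j\<in>UNIV. (cmod (V j))\<^sup>2) = (\<Sum>j\<in>UNIV. cnj (V j) * V j)"
    by (simp add: complex_norm_square mult.commute del: of_real_power)
  also have "\<dots> = (\<Sum>j\<in>UNIV. \<Sum>m<M. \<Sum>n<M. R m $ e $ j * R n $ j $ e)"
    by (simp add: V_def sum_product herm)
  also have "\<dots> = (\<Sum>m<M. \<Sum>n<M. \<Sum>j\<in>UNIV. R m $ e $ j * R n $ j $ e)"
    by (subst sum.swap, intro sum.cong refl, rule sum.swap)
  also have "\<dots> = (\<Sum>m<M. \<Sum>n<M. if m = n then of_real (s m) else 0)"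
    by (intro sum.cong refl) (simp add: sq)
  also have "\<dots> = of_real (\<Sum>m<M. s m)" by simp
  finally have norm_V: "(\<Sum>j\<in>UNIV. (cmod (V j))\<^sup>2) = (\<Sum>m<M. s m)"
    by (simp only: of_real_eq_iff)
  \<comment> \<open>The squared norms of the \<open>e\<close>-th columns are at most \<open>1/M\<close> each, but sum to at least \<open>1\<close>.\<close>
  have "V e = 1" using M0 by (simp add: V_def diag' pe)
  then have "1 \<le> (\<Sum>j\<in>UNIV. (cmod (V j))\<^sup>2)"
    using member_le_sum[of e UNIV "\<lambda>j. (cmod (V j))\<^sup>2"] by simp
  then have "(\<Sum>m<M. p e - s m) \<le> 0"
    using M0 by (simp add: norm_V sum_subtractf pe)
  then have "(\<Sum>m<M. p e - s m) = 0"
    using sum_nonneg[of "{..<M}" "\<lambda>m. p e - s m"] s_le by fastforce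
  then have s_eq: "s m = p e" if "m < M" for m
    using sum_nonneg_eq_0_iff[of "{..<M}" "\<lambda>m. p e - s m"] s_le that by auto
  \<comment> \<open>Equality in \<open>s_le\<close> forces equality in each of the bounds
    \<open>minor\<close> that were summed.\<close>
  have "(cmod (R m $ j $ e))\<^sup>2 = p j * p e" if "m < M" for m j
  proof -
    have "(\<Sum>j\<in>UNIV. p j * p e - (cmod (R m $ j $ e))\<^sup>2) = 0"
      using s_eq[OF that] unfolding s_def
      by (simp add: sum_subtractf sum_p flip: sum_distrib_right)
    then show ?thesis
      using sum_nonneg_eq_0_iff[of UNIV "\<lambda>j. p j * p e - (cmod (R m $ j $ e))\<^sup>2"]
        minor[OF that] by auto
  qed
  then have rank_one: "R m $ i $ k * R m $ k $ j = of_real (p k) * R m $ i $ j"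
    if "m < M" for m i j k
    using rank_one_entries[OF psd[OF that], of e i k j] that M0 by (simp add: diag' pe)
  \<comment> \<open>The square of a rank-one matrix is its trace times the matrix, and the trace is
    \<open>1\<close> by \<open>sum_p\<close>.\<close>
  have idem: "R m ** R m = R m" if "m < M" for m
  proof -
    have "(R m ** R m) $ i $ j = of_real (\<Sum>k\<in>UNIV. p k) * R m $ i $ j" for i j
      unfolding prod[symmetric] by (simp only: rank_one[OF that] of_real_sum sum_distrib_right)
    then show ?thesis by (simp add: vec_eq_iff sum_p)
  qed
  have cmod_R: "(cmod (R m $ i $ j))\<^sup>2 = p i * p j" if "m < M" for m i j
  proof -
    have "of_real ((cmod (R m $ i $ j))\<^sup>2) = R m $ i $ j * R m $ j $ i"
      by (simp only: complex_norm_square herm[OF that])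
    also have "\<dots> = of_real (p i * p j)"
      by (simp add: rank_one that diag')
    finally show ?thesis by (simp only: of_real_eq_iff)
  qed

  \<comment> \<open>\<open>T\<close> will turn out to be the orthogonal projection onto the common
    orthogonal complement of the ranges of the \<open>R m\<close>.\<close>
  define T where "T i j = (if i = j then 1 else 0) - (\<Sum>m<M. R m $ i $ j)" for i j
  have T_R: "(\<Sum>k\<in>UNIV. T i k * R n $ k $ j) = 0" if "n < M" for n i j
  proof -
    have "(\<Sum>k\<in>UNIV. T i k * R n $ k $ j)
        = (\<Sum>k\<in>UNIV. if i = k then R n $ k $ j else 0)
          - (\<Sum>k\<in>UNIV. \<Sum>m<M. R m $ i $ k * R n $ k $ j)"
      unfolding sum_subtractf[symmetric]
      by (intro sum.cong refl) (simp add: T_def left_diff_distrib sum_distrib_right)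
    also have "(\<Sum>k\<in>UNIV. \<Sum>m<M. R m $ i $ k * R n $ k $ j)
        = (\<Sum>m<M. (R m ** R n) $ i $ j)"
      by (subst sum.swap) (simp add: prod)
    also have "\<dots> = (\<Sum>m<M. if m = n then R n $ i $ j else 0)"
      by (intro sum.cong refl) (use that in \<open>auto simp: idem orth\<close>)
    finally show ?thesis using that by simp
  qed
  have T_T: "(\<Sum>k\<in>UNIV. T i k * T k j) = T i j" for i j
  proof -
    have "(\<Sum>k\<in>UNIV. T i k * T k j)
        = (\<Sum>k\<in>UNIV. if k = j then T i k else 0)
          - (\<Sum>k\<in>UNIV. \<Sum>m<M. T i k * R m $ k $ j)"
      unfolding sum_subtractf[symmetric]
      by (intro sum.cong refl) (simp add: T_def[of _ j] right_diff_distrib sum_distrib_left)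
    also have "(\<Sum>k\<in>UNIV. \<Sum>m<M. T i k * R m $ k $ j) = 0"
      by (subst sum.swap) (simp add: T_R)
    finally show ?thesis by simp
  qed
  have T_herm: "T j i = cnj (T i j)" for i j
    by (simp add: T_def herm)
  have T_diag: "T i i = of_real (if i \<in> {a, b, c} then 1 / 3 else 0)" for i
    using M0 by (simp add: T_def diag' p)
  \<comment> \<open>In a Hermitian idempotent the squared norm of a row is its diagonal entry; a
    zero on the diagonal therefore kills its row and column.\<close>
  have T_norm: "(\<Sum>k\<in>UNIV. (cmod (T i k))\<^sup>2) = (if i \<in> {a, b, c} then 1 / 3 else 0)" for i
  proof -
    have "of_real (\<Sum>k\<in>UNIV. (cmod (T i k))\<^sup>2) = (\<Sum>k\<in>UNIV. T i k * T k i)"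
      by (simp only: of_real_sum complex_norm_square T_herm[symmetric])
    then show ?thesis unfolding T_T T_diag by (simp only: of_real_eq_iff)
  qed
  have T_zero: "T k i = 0" "T i k = 0" if "k \<notin> {a, b, c}" for i k
  proof -
    have "(\<Sum>i\<in>UNIV. (cmod (T k i))\<^sup>2) = 0" using T_norm[of k] that by simp
    then show "T k i = 0" by (subst (asm) sum_nonneg_eq_0_iff) auto
    then show "T i k = 0" using T_herm[of i k] by simp
  qed
  have on_abc: "(\<Sum>k\<in>UNIV. g k) = g a + g b + g c"
    if "\<And>k. k \<notin> {a, b, c} \<Longrightarrow> g k = 0" for g :: "'n \<Rightarrow> 'b::comm_monoid_add"
  proof -
    have "(\<Sum>k\<in>UNIV. g k) = (\<Sum>k\<in>{a, b, c}. g k)"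
      by (rule sum.mono_neutral_right) (use that in auto)
    then show ?thesis using distinct by (simp add: add.assoc)
  qed
  have T_abc: "(cmod (T i a))\<^sup>2 + (cmod (T i b))\<^sup>2 + (cmod (T i c))\<^sup>2 = 1 / 3"
    if "i \<in> {a, b, c}" for i
    using T_norm[of i] that by (subst (asm) on_abc) (auto simp: T_zero)
  have T_sym: "cmod (T i j) = cmod (T j i)" for i j
    using T_herm[of i j] by simp
  \<comment> \<open>Without its diagonal entry, each of the three rows has squared norm
    \<open>1/3 - 1/9 = 2/9\<close>. The resulting linear equations for the three squared moduli have
    the unique solution \<open>1/9\<close>.\<close>
  have "(cmod (T a b))\<^sup>2 = (1 / 3)\<^sup>2" "(cmod (T a c))\<^sup>2 = (1 / 3)\<^sup>2"
    using T_abc[of a] T_abc[of b] T_abc[of c] T_sym[of b a] T_sym[of c a] T_sym[of c b]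
    by (simp_all add: T_diag power2_eq_square)
  then have T_mod: "cmod (T a b) = 1 / 3" "cmod (T a c) = 1 / 3"
    by (simp_all only: power2_eq_iff_nonneg norm_ge_zero zero_le_divide_1_iff zero_le_numeral)

  \<comment> \<open>The factor is the inverse of \<open>T a a * R m $ a $ a\<close>, that is, of
    \<open>2 / (9 * M)\<close>. The other two products have this same modulus, so scaling yields a
    unit triangle with one term equal to \<open>1\<close>.\<close>
  define x where "x m = of_real (9 * real M / 2) * (T a b * R m $ b $ a)" for m
  define y where "y m = of_real (9 * real M / 2) * (T a c * R m $ c $ a)" for m
  have Im_x: "Im (x m) = sqrt 3 / 2 \<or> Im (x m) = - (sqrt 3 / 2)" if "m < M" for m
  proof (rule Im_of_unit_triangle)
    have "(cmod (R m $ b $ a))\<^sup>2 = (2 / (3 * real M))\<^sup>2"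
      "(cmod (R m $ c $ a))\<^sup>2 = (2 / (3 * real M))\<^sup>2"
      unfolding cmod_R[OF that] by (simp_all add: p power2_eq_square)
    then have "cmod (R m $ b $ a) = 2 / (3 * real M)" "cmod (R m $ c $ a) = 2 / (3 * real M)"
      using M0 by (auto simp: power2_eq_iff_nonneg)
    then show "cmod (x m) = 1" "cmod (y m) = 1"
      using M0 by (simp_all add: x_def y_def norm_mult norm_divide T_mod)
    have "T a a * R m $ a $ a + T a b * R m $ b $ a + T a c * R m $ c $ a = 0"
      using T_R[OF that, of a a] by (subst (asm) on_abc) (auto simp: T_zero)
    then have "of_real (9 * real M / 2) * (T a a * R m $ a $ a) + x m + y m = 0"
      unfolding x_def y_def by (simp only: distrib_left[symmetric]) simp
    moreover have "of_real (9 * real M / 2) * (T a a * R m $ a $ a) = 1"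
      using M0 by (simp add: T_diag diag' that p)
    ultimately show "1 + x m + y m = 0" by simp
  qed
  \<comment> \<open>Off the diagonal the \<open>R m\<close> sum to \<open>- T\<close>, so the sum is
    a real multiple of \<open>T a b * cnj (T a b)\<close>.\<close>
  have "(\<Sum>m<M. x m) = of_real (9 * real M / 2) * (T a b * (- T b a))"
    using distinct by (simp add: x_def T_def[of b a] sum_distrib_left)
  also have "\<dots> = of_real (- (9 * real M / 2) * (cmod (T a b))\<^sup>2)"
    by (simp only: of_real_mult complex_norm_square T_herm[symmetric]) simp
  finally have "(\<Sum>m<M. Im (x m)) = 0"
    by (simp flip: Im_sum)
  \<comment> \<open>The vanishing sum gives \<open>k = 0\<close>, which is even, whereas
    \<open>M\<close> is odd.\<close>
  moreover obtain k :: int where "(\<Sum>m<M. Im (x m)) = sqrt 3 / 2 * of_int k" "even k \<longleftrightarrow> even M"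
    using sum_plus_minus_parity[of "{..<M}" "\<lambda>m. Im (x m)" "sqrt 3 / 2"] Im_x by auto
  ultimately show False using M by auto
qed

section \<open>Reduction to the standard basis\<close>

text \<open>Conjugation by the unitary \<open>V\<close> with columns \<open>ket i\<close> turns
  matrix elements in the given basis into entries, and it preserves positivity and orthogonality of
  the states.\<close>

lemma not_has_distinguishable_states:
  fixes ket :: "'n::finite \<Rightarrow> complex ^ 'n" and p :: "real ^ 'n"
  assumes onb: "orthonormal_basis ket"
    and M: "odd M"
    and distinct: "a \<noteq> b" "a \<noteq> c" "b \<noteq> c" "e \<notin> {a, b, c}"
    and p: "\<And>k. p $ k = (if k \<in> {a, b, c} then 2 / (3 * real M) else 1 / real M)"
    and sum_p: "(\<Sum>k\<in>UNIV. p $ k) = 1"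
  shows "\<not> has_distinguishable_states ket M p"
proof
  assume "has_distinguishable_states ket M p"
  then obtain \<rho> where psd: "\<And>m. m < M \<Longrightarrow> positive_semidefinite (\<rho> m)"
    and cv: "\<And>m. m < M \<Longrightarrow> classical_version ket (\<rho> m) = p"
    and orth: "\<And>m n. \<lbrakk>m < M; n < M; m \<noteq> n\<rbrakk> \<Longrightarrow> \<rho> m ** \<rho> n = 0"
    unfolding has_distinguishable_states_def perfectly_distinguishable_def quantum_state_def
    by blast
  define U :: "complex ^ 'n ^ 'n" where "U = (\<chi> i j. cnj (ket i $ j))"
  define V :: "complex ^ 'n ^ 'n" where "V = (\<chi> j i. ket i $ j)"
  have "U ** V = mat 1"
    using onb by (simp add: vec_eq_iff U_def V_def matrix_matrix_mult_def mat_def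
        orthonormal_basis_def braket_def)
  \<comment> \<open>Orthonormality gives only \<open>U ** V\<close>; the other order, which holds
    because the matrices are square, cancels between two states.\<close>
  then have VU: "V ** U = mat 1" by (simp add: matrix_left_right_inverse)
  have V_axis: "V *v axis k 1 = ket k" for k
    by (simp add: vec_eq_iff matrix_vector_axis V_def)
  have adjoint: "braket x (U *v z) = braket (V *v x) z" for x z
    unfolding braket_def U_def V_def matrix_vector_mult_def
    by (simp add: sum_distrib_left sum_distrib_right) (subst sum.swap, simp add: mult_ac)
  define R where "R m = U ** \<rho> m ** V" for m
  have R: "braket x (R m *v y) = braket (V *v x) (\<rho> m *v (V *v y))" for m x y
    by (simp add: R_def adjoint flip: matrix_vector_mul_assoc)
  have entry: "R m $ i $ j = braket (ket i) (\<rho> m *v ket j)" for m i j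
    using R[of "axis i 1" m "axis j 1"] by (simp add: braket_axis_left matrix_vector_axis V_axis)
  show False
  proof (rule no_orthogonal_family[of M a b c e "\<lambda>k. p $ k" R, OF M distinct p sum_p])
    fix m assume m: "m < M"
    have "\<rho> m $ j $ i = cnj (\<rho> m $ i $ j)" for i j
      using psd[OF m] unfolding positive_semidefinite_def by blast
    then have "R m $ j $ i = cnj (R m $ i $ j)" for i j
      unfolding entry by (rule hermitian_braket)
    moreover have "0 \<le> Re (braket x (R m *v x))" for x
      using psd[OF m] unfolding R positive_semidefinite_def by blast
    ultimately show "positive_semidefinite (R m)"
      unfolding positive_semidefinite_def by blast
    show "Re (R m $ k $ k) = p $ k" for k
      unfolding entry using cv[OF m] by (simp add: classical_version_def vec_eq_iff)
    fix n assume n: "n < M" "m \<noteq> n"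
    have "R m ** R n = U ** (\<rho> m ** (V ** U) ** \<rho> n) ** V"
      by (simp add: R_def matrix_mul_assoc)
    then show "R m ** R n = 0"
      using orth[OF m n] by (simp add: VU)
  qed
qed

section \<open>Vertices of the permutohedron\<close>

text \<open>Only the largest index has \<open>CARD('n) - 1\<close> predecessors, so the prefix
  vector has its single zero there; a transposition moves this zero to \<open>k\<close>.\<close>

lemma permutohedron_vertex:
  fixes k :: "'n::{finite,linorder}"
  shows "(\<chi> i. if i = k then 0 else 1 / real (CARD('n) - 1))
    \<in> {(\<chi> i. uniform_prefix (CARD('n) - 1) $ \<pi> i) |\<pi>. \<pi> permutes UNIV}"
proof -
  define t :: 'n where "t = Max UNIV"
  have le: "i \<le> t" for i by (simp add: t_def)
  have prefix: "card {j. j < i} < CARD('n) - 1 \<longleftrightarrow> i \<noteq> t" for i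
  proof
    assume "i \<noteq> t"
    then have "{j. j < i} \<subset> UNIV - {t}" using le[of i] by auto
    then have "card {j. j < i} < card (UNIV - {t})" by (intro psubset_card_mono) auto
    then show "card {j. j < i} < CARD('n) - 1" by (simp add: card_Diff_singleton)
  next
    have "{j. j < t} = UNIV - {t}" using le by (auto simp: less_le)
    then have "card {j. j < t} = CARD('n) - 1" by (simp add: card_Diff_singleton)
    then show "card {j. j < i} < CARD('n) - 1 \<Longrightarrow> i \<noteq> t" by auto
  qed
  have "Transposition.transpose k t i = t \<longleftrightarrow> i = k" for i
    by (auto simp: Transposition.transpose_def)
  then have "(\<chi> i. if i = k then 0 else 1 / real (CARD('n) - 1))
      = (\<chi> i. uniform_prefix (CARD('n) - 1) $ Transposition.transpose k t i)"
    by (simp only: vec_eq_iff uniform_prefix_def vec_lambda_beta prefix) simp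
  moreover have "Transposition.transpose k t permutes UNIV" by (simp add: permutes_swap_id)
  ultimately show ?thesis by blast
qed

section \<open>A point of the permutohedron outside the region\<close>

theorem proposition8:
  fixes ket :: "'n::{finite,linorder} \<Rightarrow> complex ^ 'n::{finite,linorder}"
  assumes "orthonormal_basis ket"
    and "CARD('n) > 2"
    and "even (CARD('n))"
  shows "\<not> (\<forall>p\<in>probability_vectors. Max (range (\<lambda>k. p $ k)) \<le> 1 / (real (CARD('n)) - 1) \<longrightarrow>
              has_distinguishable_states ket (CARD('n) - 1) p)
         \<and> distinguishability_region ket (CARD('n) - 1) \<noteq> permutohedron (CARD('n) - 1)"
proof -
  define M where "M = CARD('n) - 1"
  have odd_M: "odd M" and M3: "M \<ge> 3"
    using assms(2,3) unfolding M_def by presburger+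
  have M_real: "real M = real CARD('n) - 1" using assms(2) by (simp add: M_def)
  \<comment> \<open>An even dimension above 2 is at least 4, which leaves room for \<open>a\<close>,
    \<open>b\<close>, \<open>c\<close> and a further index \<open>e\<close>.\<close>
  obtain S :: "'n set" where "card S = 3"
    using obtain_subset_with_card_n[of 3 "UNIV :: 'n set"] assms(2) by auto
  then obtain a b c where S: "S = {a, b, c}" "a \<noteq> b" "a \<noteq> c" "b \<noteq> c"
    by (auto simp: card_3_iff)
  have "S \<noteq> UNIV" using \<open>card S = 3\<close> M3 by (auto simp: M_def)
  then obtain e where e: "e \<notin> {a, b, c}" using S by blast
  define p :: "real ^ 'n::{finite,linorder}" where
    "p = (\<chi> k. if k \<in> {a, b, c} then 2 / (3 * real M) else 1 / real M)"
  define v :: "'n \<Rightarrow> real ^ 'n::{finite,linorder}" where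
    "v k = (\<chi> i. if i = k then 0 else 1 / real M)" for k
  \<comment> \<open>At \<open>a\<close>, \<open>b\<close> or \<open>c\<close> exactly one of the
    three vertices vanishes, leaving \<open>2 / (3 * M)\<close>; elsewhere all three equal
    \<open>1 / M\<close>.\<close>
  have p_v: "p = (1/3) *\<^sub>R v a + (1/3) *\<^sub>R v b + (1/3) *\<^sub>R v c"
    using S M3 by (auto simp: vec_eq_iff p_def v_def field_simps)
  have "(\<Sum>i\<in>UNIV. v k $ i) = 1" for k
  proof -
    have "(\<Sum>i\<in>UNIV. v k $ i) = (\<Sum>i\<in>UNIV. 1 / real M - (if i = k then 1 / real M else 0))"
      by (intro sum.cong) (auto simp: v_def)
    also have "\<dots> = (real CARD('n) - 1) / real M" by (simp add: sum_subtractf diff_divide_distrib)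
    also have "\<dots> = 1" using M3 by (simp flip: M_real)
    finally show ?thesis .
  qed
  then have sum_p: "(\<Sum>i\<in>UNIV. p $ i) = 1"
    by (simp add: p_v sum.distrib flip: sum_divide_distrib)
  then have prob: "p \<in> probability_vectors"
    by (simp add: probability_vectors_def p_def)
  have "p $ k \<le> 1 / (real CARD('n) - 1)" for k
    using M3 by (simp add: p_def flip: M_real) (simp add: field_simps)
  then have max: "Max (range (\<lambda>k. p $ k)) \<le> 1 / (real CARD('n) - 1)"
    by (subst Max_le_iff) auto
  have not_states: "\<not> has_distinguishable_states ket M p"
    using not_has_distinguishable_states[OF assms(1) odd_M S(2-4) e _ sum_p]
    by (simp add: p_def)
  have "p \<in> convex hull {v a, v b, v c}"
    unfolding convex_hull_3 p_v by (intro CollectI exI[of _ "1/3"]) simp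
  also have "\<dots> \<subseteq> permutohedron M"
    unfolding permutohedron_def v_def M_def
    by (intro hull_mono) (use permutohedron_vertex in blast)
  finally have "p \<in> permutohedron M" .
  moreover have "p \<notin> distinguishability_region ket M"
    using not_states by (simp add: distinguishability_region_def)
  ultimately show ?thesis
    using prob max not_states unfolding M_def by blast
qed

end
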